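(* Let $0<r\le 1$ and $0<u\le 1$, and consider the two-ball, three-box multi-look search-cost game with box costs $(a,b,c)=(1,r,ru)$. Suppose $A_2\ge0$ and $K_2\ge0$, where $$A_2=r^2(1+u)^2+r-u-1,\qquad K_2=1-r(1+u)+r^2(1-u-u^2),$$ and let $$Q_2=-2r^3u^3-4r^3u^2-2r^3u-r^2u^3-3r^2u^2-3r^2u+ru+u+2.$$ If $Q_2\le0$, there is a Searcher mixture supported on the policies $\{26,27,33,38,39\}$; if $Q_2\ge0$, there is a Searcher mixture supported on the policies $\{26,33,37,38,41\}$. In both cases the mixture has nonnegative weights summing to one and guarantees expected cost at most $V_2$ against every Hider placement $x\in\mathcal H$.
   Context: The game. There are three boxes $A,B,C$ with search costs $a,b,c$ respectively. The Hider places two identical balls in the boxes; the placements are $\mathcal H=\{002,011,020,101,110,200\}$, where $x=x_1x_2x_3$ has $x_1,x_2,x_3$ balls in $A,B,C$ respectively. The Searcher opens boxes one at a time, each opening costing that box's search cost. If the opened box currently contains at least one ball, exactly one ball is recovered (removed) and she observes only "success"; otherwise she observes "failure", so she learns that the box is empty. The cost $C_s(x)$ of a deterministic adaptive policy $s$ against placement $x$ is the total cost paid until both balls are found. A Searcher mixture with weights $w_s$ on policies $s$ has expected cost $\sum_s w_sC_s(x)$ against $x$; "supported on" a set of policies means that only policies in that set receive weight. The value $V_2$ (evaluated at $(a,b,c)=(1,r,ru)$). Put $T_2=a^2+b^2+c^2+ab+ac+bc$ and $T_3=a^3+b^3+c^3+a^2b+a^2c+ab^2+b^2c+ac^2+bc^2+abc$;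 then $$V_2=\frac{2T_3-c^2(a+b+2c)}{T_2-c^2}.$$ Policy notation. $i\mid\sigma\mid R_{jk}$ or $i\mid\sigma\mid S_{jk}$ (with $\{i,j,k\}=\{A,B,C\}$ and $\sigma$ an ordering of the boxes) denotes the following policy. First open box $i$. If this succeeds, inspect the boxes in the order $\sigma$ until the remaining ball is found. If the first opening fails, open $j$ next. If the opening of $j$ succeeds, then under $R_{jk}$ open $j$ again (and, if that fails, open $k$), while under $S_{jk}$ open $k$ (and, if that fails, open $j$). If the opening of $j$ fails, open $k$ twice. The numbered policies are: 26: $B\mid BCA\mid R_{AC}$; 27: $C\mid ABC\mid R_{BA}$; 33: $A\mid ABC\mid S_{BC}$; 37: $A\mid CAB\mid R_{BC}$; 38: $A\mid BCA\mid R_{BC}$; 39: $A\mid ACB\mid R_{BC}$; 41: $A\mid ABC\mid R_{BC}$. *)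

theory Defs
  imports Complex_Main
begin

datatype box = A | B | C

type_synonym placement = "box \<Rightarrow> nat"

fun pl :: "nat \<Rightarrow> nat \<Rightarrow> nat \<Rightarrow> placement" where
  "pl m n k A = m"
| "pl m n k B = n"
| "pl m n k C = k"

definition placements :: "placement set" where
  "placements = {pl 0 0 2, pl 0 1 1, pl 0 2 0, pl 1 0 1, pl 1 1 0, pl 2 0 0}"

text \<open>A deterministic adaptive policy is a decision tree: \<open>Open i s f\<close> opens box \<open>i\<close> and
  continues with \<open>s\<close> on success and with \<open>f\<close> on failure. The search is over as soon as no
  ball is left, so whatever the tree prescribes after that point is never executed.\<close>

datatype policy = Stop | Open box policy policy

definition remove_ball :: "box \<Rightarrow> placement \<Rightarrow> placement" where
  "remove_ball i x = x(i := x i - 1)"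

fun search_cost :: "(box \<Rightarrow> real) \<Rightarrow> policy \<Rightarrow> placement \<Rightarrow> real" where
  "search_cost \<gamma> Stop x = 0"
| "search_cost \<gamma> (Open i s f) x =
    (if \<forall>j. x j = 0 then 0
     else \<gamma> i + (if x i > 0 then search_cost \<gamma> s (remove_ball i x) else search_cost \<gamma> f x))"

text \<open>A tree may also reach \<open>Stop\<close> while balls are still hidden, in which case
  \<open>search_cost\<close> is not the cost of a completed search. Such trees are not policies of the
  game and are excluded by the following predicate.\<close>

fun finds_all :: "policy \<Rightarrow> placement \<Rightarrow> bool" where
  "finds_all Stop x \<longleftrightarrow> (\<forall>j. x j = 0)"
| "finds_all (Open i s f) x \<longleftrightarrow>
    (\<forall>j. x j = 0) \<or> (if x i > 0 then finds_all s (remove_ball i x) else finds_all f x)"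

definition game_policies :: "policy set" where
  "game_policies = {s. \<forall>x\<in>placements. finds_all s x}"

definition searcher_mixture :: "(policy \<Rightarrow> real) \<Rightarrow> bool" where
  "searcher_mixture w \<longleftrightarrow>
     (\<forall>s. w s \<ge> 0) \<and> finite {s. w s \<noteq> 0} \<and> {s. w s \<noteq> 0} \<subseteq> game_policies \<and>
     (\<Sum>s\<in>{s. w s \<noteq> 0}. w s) = 1"

definition supported_on :: "(policy \<Rightarrow> real) \<Rightarrow> policy set \<Rightarrow> bool" where
  "supported_on w S \<longleftrightarrow> {s. w s \<noteq> 0} \<subseteq> S"

definition expected_cost :: "(box \<Rightarrow> real) \<Rightarrow> (policy \<Rightarrow> real) \<Rightarrow> placement \<Rightarrow> real" where
  "expected_cost \<gamma> w x = (\<Sum>s\<in>{s. w s \<noteq> 0}. w s * search_cost \<gamma> s x)"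

fun box_costs :: "real \<Rightarrow> real \<Rightarrow> real \<Rightarrow> box \<Rightarrow> real" where
  "box_costs a b c A = a"
| "box_costs a b c B = b"
| "box_costs a b c C = c"

text \<open>Inspect the listed boxes in turn until one remaining ball is found.\<close>

fun inspect :: "box list \<Rightarrow> policy" where
  "inspect [] = Stop"
| "inspect (i # is) = Open i Stop (inspect is)"

definition open_twice :: "box \<Rightarrow> policy" where
  "open_twice k = (let t = Open k Stop Stop in Open k t t)"

text \<open>The policies $i\mid\sigma\mid R_{jk}$ and $i\mid\sigma\mid S_{jk}$.\<close>

definition policy_R :: "box \<Rightarrow> box list \<Rightarrow> box \<Rightarrow> box \<Rightarrow> policy" where
  "policy_R i \<sigma> j k = Open i (inspect \<sigma>) (Open j (inspect [j, k]) (open_twice k))"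

definition policy_S :: "box \<Rightarrow> box list \<Rightarrow> box \<Rightarrow> box \<Rightarrow> policy" where
  "policy_S i \<sigma> j k = Open i (inspect \<sigma>) (Open j (inspect [k, j]) (open_twice k))"

definition "policy26 = policy_R B [B, C, A] A C"
definition "policy27 = policy_R C [A, B, C] B A"
definition "policy33 = policy_S A [A, B, C] B C"
definition "policy37 = policy_R A [C, A, B] B C"
definition "policy38 = policy_R A [B, C, A] B C"
definition "policy39 = policy_R A [A, C, B] B C"
definition "policy41 = policy_R A [A, B, C] B C"

definition T2 :: "real \<Rightarrow> real \<Rightarrow> real \<Rightarrow> real" where
  "T2 a b c = a^2 + b^2 + c^2 + a*b + a*c + b*c"

definition T3 :: "real \<Rightarrow> real \<Rightarrow> real \<Rightarrow> real" where
  "T3 a b c = a^3 + b^3 + c^3 + a^2*b + a^2*c + a*b^2 + b^2*c + a*c^2 + b*c^2 + a*b*c"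

definition V2 :: "real \<Rightarrow> real \<Rightarrow> real \<Rightarrow> real" where
  "V2 a b c = (2 * T3 a b c - c^2 * (a + b + 2*c)) / (T2 a b c - c^2)"

definition A2 :: "real \<Rightarrow> real \<Rightarrow> real" where
  "A2 r u = r^2 * (1 + u)^2 + r - u - 1"

definition K2 :: "real \<Rightarrow> real \<Rightarrow> real" where
  "K2 r u = 1 - r * (1 + u) + r^2 * (1 - u - u^2)"

definition Q2 :: "real \<Rightarrow> real \<Rightarrow> real" where
  "Q2 r u = -2*r^3*u^3 - 4*r^3*u^2 - 2*r^3*u - r^2*u^3 - 3*r^2*u^2 - 3*r^2*u + r*u + u + 2"

end

theory Submission
  imports Defs
begin

text \<open>
  Every one of the policies costs \<open>a + b + 2c\<close> against 002, so mixing them cannot help there. The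
  mixture is therefore chosen to equalise the other five placements. With five policies in
  the support, equal costs and total weight one are five linear equations for five weights; they
  are solved by Cramer's rule, and the common cost turns out to be \<open>V\<^sub>2\<close>. Over a common denominator
  the weights are polynomials in \<open>r\<close> and \<open>u\<close>, and the equalities are polynomial identities. Two
  things are left to check.

  First, 002 must not cost more than \<open>V\<^sub>2\<close>. The gap \<open>V\<^sub>2 - (a + b + 2c)\<close> is \<open>(1 + r) K\<^sub>2\<close> divided by the
  positive denominator of \<open>V\<^sub>2\<close> (lemma \<open>value_minus_cost_002\<close>), so this is the role of \<open>K\<^sub>2 \<ge> 0\<close>.

  Second, the weights must be nonnegative. For the support \<open>{26, 33, 37, 38, 41}\<close>, the weight of 26
  is a positive multiple of \<open>A\<^sub>2\<close>, that of 41 is a positive multiple of \<open>Q\<^sub>2\<close>, that of 37 is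
  \<open>(1 - r) A\<^sub>2\<close> plus monomials with positive coefficients, up to a positive factor, and the other
  two are positive. So the equalising weights on this support are admissible precisely up to the
  point where \<open>Q\<^sub>2\<close> changes sign. For
  \<open>Q\<^sub>2 \<le> 0\<close> the support is \<open>{26, 27, 33, 38, 39}\<close>. There \<open>Q\<^sub>2 \<le> 0\<close> keeps \<open>u\<close> away from 0, and together
  with \<open>K\<^sub>2 \<ge> 0\<close>, which bounds \<open>u\<close> from above in terms of \<open>r\<close>, it forces \<open>r \<ge> 3/4\<close>
  (lemma \<open>r_lower_bound\<close>). On this strip each weight is a visibly nonnegative expression plus a
  nonnegative multiple of \<open>K\<^sub>2\<close> or of \<open>-Q\<^sub>2\<close>.
\<close>

section \<open>Mixtures given by a list of weighted policies\<close>

text \<open>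
  A policy may occur repeatedly in the list, in which case its weights add up. So expected costs
  are sums over the list, and no two policies have to be told apart.
\<close>

fun mixture_of :: "(policy \<times> real) list \<Rightarrow> policy \<Rightarrow> real" where
  "mixture_of [] s = 0"
| "mixture_of ((p, q) # ps) s = (if s = p then q else 0) + mixture_of ps s"

lemma mixture_of_eq_0:
  "s \<notin> fst ` set ps \<Longrightarrow> mixture_of ps s = 0"
  by (induction ps s rule: mixture_of.induct) auto

lemma mixture_of_nonneg:
  "\<forall>(p, q) \<in> set ps. 0 \<le> q \<Longrightarrow> 0 \<le> mixture_of ps s"
  by (induction ps s rule: mixture_of.induct) auto

lemma sum_mixture_of_superset:
  assumes "finite S" "fst ` set ps \<subseteq> S"
  shows "(\<Sum>s\<in>S. mixture_of ps s * f s) = (\<Sum>(p, q)\<leftarrow>ps. q * f p)"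
  using assms(2)
proof (induction ps)
  case Nil
  then show ?case by simp
next
  case (Cons pq ps)
  obtain p q where pq: "pq = (p, q)" by (cases pq)
  have "(\<Sum>s\<in>S. mixture_of (pq # ps) s * f s)
      = (\<Sum>s\<in>S. if s = p then q * f s else 0) + (\<Sum>s\<in>S. mixture_of ps s * f s)"
    unfolding pq sum.distrib [symmetric]
    by (rule sum.cong) (auto simp: algebra_simps)
  then show ?case
    using Cons assms(1) by (simp add: pq)
qed

lemma sum_mixture_of:
  "(\<Sum>s\<in>{s. mixture_of ps s \<noteq> 0}. mixture_of ps s * f s) = (\<Sum>(p, q)\<leftarrow>ps. q * f p)"
proof -
  have "(\<Sum>s\<in>{s. mixture_of ps s \<noteq> 0}. mixture_of ps s * f s)
      = (\<Sum>s\<in>fst ` set ps. mixture_of ps s * f s)"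
    by (rule sum.mono_neutral_left) (auto dest: mixture_of_eq_0)
  then show ?thesis
    by (simp add: sum_mixture_of_superset)
qed

text \<open>
  Weights with a common denominator \<open>M\<close> enter through their numerators, so that the total weight and
  the expected costs become division-free polynomial conditions.
\<close>

lemma mixture_from_unnormalised_weights:
  fixes M V :: real
  assumes "0 < M"
    and total: "(\<Sum>(p, n)\<leftarrow>ps. n) = M"
    and nonneg: "\<forall>(p, n) \<in> set ps. 0 \<le> n"
    and policies: "fst ` set ps \<subseteq> S" "fst ` set ps \<subseteq> game_policies"
    and cost: "\<And>x. x \<in> placements \<Longrightarrow> (\<Sum>(p, n)\<leftarrow>ps. n * search_cost \<gamma> p x) \<le> V * M"
  shows "\<exists>w. searcher_mixture w \<and> supported_on w S \<and>
           (\<forall>x\<in>placements. expected_cost \<gamma> w x \<le> V)"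
proof -
  define qs where "qs = map (\<lambda>(p, n). (p, n / M)) ps"
  define w where "w = mixture_of qs"
  have fst_qs: "fst ` set qs = fst ` set ps"
    by (force simp: qs_def)
  have scale: "(\<Sum>(p, q)\<leftarrow>qs. q * f p) = (\<Sum>(p, n)\<leftarrow>ps. n * f p) / M" for f
    unfolding qs_def by (induction ps) (auto simp: add_divide_distrib)
  have supp: "{s. w s \<noteq> 0} \<subseteq> fst ` set ps"
    using mixture_of_eq_0 fst_qs unfolding w_def by blast
  have "0 \<le> w s" for s
    unfolding w_def using nonneg \<open>0 < M\<close>
    by (intro mixture_of_nonneg) (auto simp: qs_def)
  moreover have "(\<Sum>s\<in>{s. w s \<noteq> 0}. w s) = 1"
    using sum_mixture_of [of qs "\<lambda>_. 1"] scale [of "\<lambda>_. 1"] total \<open>0 < M\<close>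
    by (simp add: w_def)
  moreover have "finite {s. w s \<noteq> 0}"
    using supp by (rule finite_subset) simp
  ultimately have "searcher_mixture w"
    using supp policies(2) unfolding searcher_mixture_def by blast
  moreover have "supported_on w S"
    using supp policies(1) unfolding supported_on_def by blast
  moreover have "expected_cost \<gamma> w x \<le> V" if "x \<in> placements" for x
    using cost [OF that] \<open>0 < M\<close>
    unfolding expected_cost_def w_def sum_mixture_of scale
    by (simp add: pos_divide_le_eq)
  ultimately show ?thesis by blast
qed

section \<open>The seven policies\<close>

lemma all_box: "(\<forall>j. P j) \<longleftrightarrow> P A \<and> P B \<and> P C"
  by (metis box.exhaust)

lemmas policy_defs =
  policy26_def policy27_def policy33_def policy37_def policy38_def policy39_def policy41_def
  policy_R_def policy_S_def open_twice_def Let_def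

lemma game_policies:
  "policy26 \<in> game_policies" "policy27 \<in> game_policies" "policy33 \<in> game_policies"
  "policy37 \<in> game_policies" "policy38 \<in> game_policies" "policy39 \<in> game_policies"
  "policy41 \<in> game_policies"
  by (simp_all add: game_policies_def placements_def policy_defs remove_ball_def all_box)

text \<open>
  Six costs in one equation, so that the cost matrix of the game can be displayed row by row.
\<close>

definition cost_vector :: "(box \<Rightarrow> real) \<Rightarrow> policy \<Rightarrow> real list" where
  "cost_vector \<gamma> s = map (search_cost \<gamma> s)
     [pl 0 0 2, pl 0 1 1, pl 0 2 0, pl 1 0 1, pl 1 1 0, pl 2 0 0]"

lemma placements_cases:
  assumes "x \<in> placements"
  obtains "x = pl 0 0 2" | "x = pl 0 1 1" | "x = pl 0 2 0"
    | "x = pl 1 0 1" | "x = pl 1 1 0" | "x = pl 2 0 0"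
  using assms unfolding placements_def by blast

lemma cost_table:
  "cost_vector (box_costs a b c) policy26 =
     [a + b + 2*c, 2*b + c, 2*b, 2*a + b + c, a + 2*b + c, 2*a + b]"
  "cost_vector (box_costs a b c) policy27 =
     [a + b + 2*c, a + b + c, 2*b + c, a + c, a + 2*b + c, 2*a + b + c]"
  "cost_vector (box_costs a b c) policy33 =
     [a + b + 2*c, a + b + c, a + 2*b + c, 2*a + b + c, 2*a + b, 2*a]"
  "cost_vector (box_costs a b c) policy37 =
     [a + b + 2*c, a + 2*b + c, a + 2*b, a + c, 2*a + b + c, 2*a + c]"
  "cost_vector (box_costs a b c) policy38 =
     [a + b + 2*c, a + 2*b + c, a + 2*b, a + b + c, a + b, 2*a + b + c]"
  "cost_vector (box_costs a b c) policy39 =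
     [a + b + 2*c, a + 2*b + c, a + 2*b, 2*a + c, 2*a + b + c, 2*a]"
  "cost_vector (box_costs a b c) policy41 =
     [a + b + 2*c, a + 2*b + c, a + 2*b, 2*a + b + c, 2*a + b, 2*a]"
  by (simp_all add: cost_vector_def policy_defs remove_ball_def all_box)

lemmas cost_table_entries = cost_table [unfolded cost_vector_def list.map list.inject simp_thms]

section \<open>The value\<close>

text \<open>
  At \<open>(a, b, c) = (1, r, ru)\<close>, the numerator and denominator of \<open>V\<^sub>2\<close> as polynomials in \<open>r\<close> and \<open>u\<close>.
\<close>

definition value_denom :: "real \<Rightarrow> real \<Rightarrow> real" where
  "value_denom r u = 1 + r + r^2 + r*u + r^2*u"

definition value_num :: "real \<Rightarrow> real \<Rightarrow> real" where
  "value_num r u =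
     2 * (1 + r + r^2 + r^3 + r*u + r^2*u + r^3*u + r^2*u^2 + r^3*u^2 + r^3*u^3)
     - r^2*u^2 * (1 + r + 2*r*u)"

lemma V2_eq: "V2 1 r (r*u) = value_num r u / value_denom r u"
  by (simp add: V2_def T2_def T3_def value_num_def value_denom_def power2_eq_square
      power3_eq_cube algebra_simps)

text \<open>
  This is where \<open>K\<^sub>2\<close> comes from: its sign decides whether 002, which costs \<open>1 + r + 2ru\<close> under every
  policy in question, stays below the value.
\<close>

lemma value_minus_cost_002:
  "value_num r u - (1 + r + 2*(r*u)) * value_denom r u = (1 + r) * K2 r u"
  unfolding value_num_def value_denom_def K2_def by algebra

lemma value_denom_pos: "0 < r \<Longrightarrow> 0 < u \<Longrightarrow> 0 < value_denom r u"
  unfolding value_denom_def by (simp add: add_pos_pos)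

section \<open>The mixture for nonnegative Q2\<close>

text \<open>
  Cramer's rule for the support \<open>{26, 33, 37, 38, 41}\<close>, with the common denominator
  \<open>(1 + u) (1 + r + ru)\<close> times the denominator of \<open>V\<^sub>2\<close>. Over it, policy 41 gets the numerator \<open>Q\<^sub>2\<close>,
  and the numerators of 37 and 38 are the following polynomials, the first one arranged to show
  its sign.
\<close>

definition weight37_pos :: "real \<Rightarrow> real \<Rightarrow> real" where
  "weight37_pos r u = (1 - r) * A2 r u + 2*r*u + 2*r*u^2 + 2*r^2*u^2 + r^2*u^3"

definition weight38_pos :: "real \<Rightarrow> real \<Rightarrow> real" where
  "weight38_pos r u = 1 + u - r*u^2 + r^2*u + r^3*(1 + u)^3"

lemma mixture_Q2_nonneg:
  fixes r u :: real
  assumes "0 < r" "r \<le> 1" "0 < u" "u \<le> 1" "0 \<le> A2 r u" "0 \<le> K2 r u" "0 \<le> Q2 r u"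
  shows "\<exists>w. searcher_mixture w \<and>
           supported_on w {policy26, policy33, policy37, policy38, policy41} \<and>
           (\<forall>x\<in>placements. expected_cost (box_costs 1 r (r * u)) w x \<le> V2 1 r (r * u))"
proof -
  let ?d = "value_denom r u" and ?e = "1 + r + r*u"
  define n26 n33 where "n26 = ?e * A2 r u" and "n33 = u * ?e * ?d"
  define M where "M = (1 + u) * ?e * ?d"
  note defs = n26_def n33_def weight37_pos_def weight38_pos_def M_def A2_def Q2_def value_denom_def value_num_def
  have pos: "0 < ?d" "0 < ?e"
    using assms value_denom_pos by (auto simp: add_pos_pos)
  have V: "V2 1 r (r*u) * M = (1 + u) * ?e * value_num r u"
    using pos by (simp add: V2_eq M_def)
  have total: "n26 + n33 + weight37_pos r u + weight38_pos r u + Q2 r u = M"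
    unfolding defs by algebra
  have "0 \<le> n26" "0 \<le> n33"
    using assms pos by (simp_all add: n26_def n33_def)
  have "0 \<le> weight37_pos r u"
    using assms unfolding weight37_pos_def by (intro add_nonneg_nonneg mult_nonneg_nonneg) auto
  have "0 \<le> weight38_pos r u"
  proof -
    have "r * u^2 \<le> 1"
      using assms by (intro mult_le_one power_le_one) auto
    moreover have "0 \<le> r^2*u + r^3*(1 + u)^3"
      using assms by simp
    ultimately show ?thesis
      using assms by (simp add: weight38_pos_def)
  qed
  have cost_002:
    "n26 * (1 + r + 2*(r*u)) + n33 * (1 + r + 2*(r*u)) + weight37_pos r u * (1 + r + 2*(r*u))
       + weight38_pos r u * (1 + r + 2*(r*u)) + Q2 r u * (1 + r + 2*(r*u)) \<le> (1 + u) * ?e * value_num r u"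
  proof -
    have "n26 * (1 + r + 2*(r*u)) + n33 * (1 + r + 2*(r*u)) + weight37_pos r u * (1 + r + 2*(r*u))
         + weight38_pos r u * (1 + r + 2*(r*u)) + Q2 r u * (1 + r + 2*(r*u))
        = (1 + r + 2*(r*u)) * M"
      unfolding total [symmetric] by algebra
    moreover have "0 \<le> (1 + u) * ?e * ((1 + r) * K2 r u)"
      using assms pos by simp
    then have "(1 + r + 2*(r*u)) * M \<le> (1 + u) * ?e * value_num r u"
      unfolding value_minus_cost_002 [symmetric] M_def by (simp add: algebra_simps)
    ultimately show ?thesis by simp
  qed
  have costs:
    "n26 * (2*r + r*u) + n33 * (1 + r + r*u) + weight37_pos r u * (1 + 2*r + r*u)
       + weight38_pos r u * (1 + 2*r + r*u) + Q2 r u * (1 + 2*r + r*u) = (1 + u) * ?e * value_num r u"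
    "n26 * (2*r) + n33 * (1 + 2*r + r*u) + weight37_pos r u * (1 + 2*r)
       + weight38_pos r u * (1 + 2*r) + Q2 r u * (1 + 2*r) = (1 + u) * ?e * value_num r u"
    "n26 * (2 + r + r*u) + n33 * (2 + r + r*u) + weight37_pos r u * (1 + r*u)
       + weight38_pos r u * (1 + r + r*u) + Q2 r u * (2 + r + r*u) = (1 + u) * ?e * value_num r u"
    "n26 * (1 + 2*r + r*u) + n33 * (2 + r) + weight37_pos r u * (2 + r + r*u)
       + weight38_pos r u * (1 + r) + Q2 r u * (2 + r) = (1 + u) * ?e * value_num r u"
    "n26 * (2 + r) + n33 * 2 + weight37_pos r u * (2 + r*u)
       + weight38_pos r u * (2 + r + r*u) + Q2 r u * 2 = (1 + u) * ?e * value_num r u"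
    unfolding defs by algebra+
  show ?thesis
  proof (rule mixture_from_unnormalised_weights)
    let ?ps = "[(policy26, n26), (policy33, n33), (policy37, weight37_pos r u),
                 (policy38, weight38_pos r u), (policy41, Q2 r u)]"
    show "0 < M"
      using assms pos by (simp add: M_def)
    show "(\<Sum>(p, n)\<leftarrow>?ps. n) = M"
      by (simp add: total [symmetric])
    show "\<forall>(p, n) \<in> set ?ps. 0 \<le> n"
      using \<open>0 \<le> n26\<close> \<open>0 \<le> n33\<close> \<open>0 \<le> weight37_pos r u\<close> \<open>0 \<le> weight38_pos r u\<close> assms by simp
    show "fst ` set ?ps \<subseteq> game_policies"
      by (simp add: game_policies)
    show "(\<Sum>(p, n)\<leftarrow>?ps. n * search_cost (box_costs 1 r (r * u)) p x) \<le> V2 1 r (r * u) * M"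
      if "x \<in> placements" for x
      using that costs cost_002
      by (cases rule: placements_cases)
        (simp_all add: cost_table_entries V add.assoc del: One_nat_def)
  qed simp
qed

section \<open>The mixture for nonpositive Q2\<close>

text \<open>
  At \<open>u = 0\<close> the polynomial \<open>Q\<^sub>2\<close> is 2, and its negative terms, which all carry a factor \<open>u\<close>, are largest
  in size at \<open>r = 1\<close>; up to \<open>u = 1/4\<close> they do not use up the constant 2.
\<close>

lemma u_lower_bound:
  fixes r u :: real
  assumes "0 < r" "r \<le> 1" "0 < u" "Q2 r u \<le> 0"
  shows "1/4 < u"
proof (rule ccontr)
  assume "\<not> 1/4 < u"
  then have "u \<le> 1/4" by simp
  have "r^2 \<le> 1" "r^3 \<le> 1"
    using assms by (auto intro: power_le_one)
  have "r^2 * (u * (3 + 3*u + u^2)) \<le> 1 * (1/4 * (3 + 3*(1/4) + (1/4)^2))"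
    using assms \<open>u \<le> 1/4\<close> \<open>r^2 \<le> 1\<close>
    by (intro mult_mono add_mono power_mono) auto
  moreover have "r^3 * (u * (1 + u)^2) \<le> 1 * (1/4 * (1 + 1/4)^2)"
    using assms \<open>u \<le> 1/4\<close> \<open>r^3 \<le> 1\<close>
    by (intro mult_mono power_mono) auto
  moreover have "Q2 r u = 2 + u + r*u - r^2 * (u * (3 + 3*u + u^2)) - 2 * (r^3 * (u * (1 + u)^2))"
    unfolding Q2_def by algebra
  moreover have "0 < r*u"
    using assms by simp
  ultimately show False
    using assms by (simp add: power2_eq_square)
qed

text \<open>
  In terms of \<open>v = ru\<close> and \<open>k = 1 - r + r\<^sup>2\<close>, the condition \<open>K\<^sub>2 \<ge> 0\<close> reads \<open>v (1 + r + v) \<le> k\<close>. In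
  \<open>Q\<^sub>2\<close> this product occurs with the negative coefficient \<open>-(2 (r + v) + 1)\<close>, and replacing it by \<open>k\<close>
  gives \<open>Q\<^sub>2 \<ge> 2 + 2v (1 - k) + u (1 - v\<^sup>2) - k (1 + 2r)\<close>. For \<open>r < 3/4\<close> the last term exceeds 2 by at most 1/32,
  which \<open>u (1 - v\<^sup>2)\<close> outweighs, because \<open>u > 1/4\<close> and, again by \<open>K\<^sub>2 \<ge> 0\<close>, \<open>v \<le> 3/4\<close>.
\<close>

lemma r_lower_bound:
  fixes r u :: real
  assumes "0 < r" "r \<le> 1" "0 < u" "0 \<le> K2 r u" "Q2 r u \<le> 0"
  shows "3/4 \<le> r"
proof (rule ccontr)
  assume "\<not> 3/4 \<le> r"
  then have r: "r < 3/4" by simp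
  define v k where "v = r*u" and "k = 1 - r + r^2"
  have v: "0 < v"
    using assms by (simp add: v_def)
  have K: "0 \<le> k - v * (1 + r + v)"
    using assms unfolding K2_def v_def k_def by (simp add: algebra_simps power2_eq_square)
  have k: "k \<le> 1"
    using assms by (simp add: k_def power2_eq_square mult_left_le)
  have "v \<le> 3/4"
  proof (rule ccontr)
    assume "\<not> v \<le> 3/4"
    then have "3/4 * (1 + 3/4) \<le> v * (1 + r + v)"
      using assms by (intro mult_mono) auto
    then show False
      using K k by simp
  qed
  then have "v^2 \<le> (3/4)^2"
    using v by (intro power_mono) auto
  have "u * (7/16) \<le> u * (1 - v^2)"
    using assms \<open>v^2 \<le> (3/4)^2\<close> by (intro mult_left_mono) (auto simp: power2_eq_square)
  moreover have "1/4 < u"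
    using assms by (intro u_lower_bound) auto
  moreover have "k * (1 + 2*r) \<le> 65/32"
  proof -
    have "65/32 - k * (1 + 2*r) = (3/4 - r) * (11/8 + 1/2*r + 2*r^2)"
      unfolding k_def by algebra
    also have "\<dots> \<ge> 0"
      using assms r by simp
    finally show ?thesis by simp
  qed
  moreover have "0 \<le> 2*v*(1 - k)"
    using v k by simp
  moreover have "0 \<le> (k - v * (1 + r + v)) * (2 * (r + v) + 1)"
    using assms v K by simp
  moreover have "Q2 r u = 2 + 2*v*(1 - k) + u * (1 - v^2) - k * (1 + 2*r)
      + (k - v * (1 + r + v)) * (2 * (r + v) + 1)"
    unfolding Q2_def v_def k_def by algebra
  ultimately show False
    using assms by linarith
qed

text \<open>
  Cramer's rule for the support \<open>{26, 27, 33, 38, 39}\<close>, with the common denominator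
  \<open>r (2r - u + 5ru + 2ru\<^sup>2)\<close> times the denominator of \<open>V\<^sub>2\<close>. The numerators of 26, 27 and 38 carry a
  further factor \<open>r\<close>, which is left out here.
\<close>

definition weight26_neg :: "real \<Rightarrow> real \<Rightarrow> real" where
  "weight26_neg r u = 1 + u - 3*r - 6*r*u - 2*r*u^2 + 3*r^2 - 3*r^2*u^2
     + 2*r^3 + 6*r^3*u + 5*r^3*u^2 + 2*r^3*u^3"

definition weight27_neg :: "real \<Rightarrow> real \<Rightarrow> real" where
  "weight27_neg r u = - 1 - u + r + r*u + r*u^2 - r^2 + r^2*u + 3*r^2*u^2 + 2*r^2*u^3
     + r^3*u + 3*r^3*u^2 + 2*r^3*u^3"

definition weight33_neg :: "real \<Rightarrow> real \<Rightarrow> real" where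
  "weight33_neg r u = - 1 + 2*r + r*u - 2*r^2 + 3*r^2*u + 2*r^2*u^2
     + r^3 + 2*r^3*u + 3*r^3*u^2 + r^4*u + 2*r^4*u^2"

definition weight38_neg :: "real \<Rightarrow> real \<Rightarrow> real" where
  "weight38_neg r u = u + 2*r + 2*r*u - 2*r*u^2 - 2*r^2 - r^2*u^2
     + 2*r^3 + 5*r^3*u + 2*r^3*u^2"

definition weight39_neg :: "real \<Rightarrow> real \<Rightarrow> real" where
  "weight39_neg r u = 1 - 2*r - 3*r*u + 4*r^2 + 4*r^2*u + 2*r^2*u^2
     + r^3 + 3*r^3*u + 4*r^3*u^2 - 2*r^4 - 6*r^4*u - 5*r^4*u^2 - 2*r^4*u^3"

context
  fixes r u :: real
  assumes r: "3/4 \<le> r" "r \<le> 1" and u: "0 < u" "u \<le> 1"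
begin

text \<open>
  The troublesome terms \<open>-6ru + 6r\<^sup>3u\<close> vanish at \<open>r = 1\<close>, and they are absorbed by \<open>6 (1 - r) K\<^sub>2\<close>. What
  is free of \<open>u\<close> afterwards is the cubic \<open>-5 + 9r - 9r\<^sup>2 + 8r\<^sup>3\<close>. It is positive from slightly below
  \<open>r = 3/4\<close> on, which is what dictates the bound on \<open>r\<close>.
\<close>

lemma weight26_neg_nonneg:
  assumes "0 \<le> K2 r u"
  shows "0 \<le> weight26_neg r u"
proof -
  have "0 \<le> 6 * (1 - r) * K2 r u"
    using assms r by simp
  \<comment> \<open>the cubic, divided by \<open>r - 3/4\<close> with remainder\<close>
  moreover have "0 \<le> (r - 3/4) * (27/4 - 3*r + 8*r^2) + 1/16"
  proof -
    have "0 \<le> 27/4 - 3*r + 8*r^2"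
      using r zero_le_power2 [of r] by linarith
    then show ?thesis
      using r by simp
  qed
  moreover have "0 \<le> u * (1 - (r*u) * ((1 - r) * (2 - r)))"
  proof -
    have "(r*u) * ((1 - r) * (2 - r)) \<le> 1 * (1/4 * 2)"
      using r u by (intro mult_mono mult_le_one) auto
    then show ?thesis
      using u by simp
  qed
  moreover have "0 \<le> 2*r^3*u^3"
    using r u by simp
  moreover have "weight26_neg r u = 6 * (1 - r) * K2 r u + ((r - 3/4) * (27/4 - 3*r + 8*r^2) + 1/16)
      + u * (1 - (r*u) * ((1 - r) * (2 - r))) + 2*r^3*u^3"
    unfolding weight26_neg_def K2_def by algebra
  ultimately show ?thesis by linarith
qed

text \<open>
  Here and for policy 33 the obstruction is the constant term -1, which adding \<open>Q\<^sub>2 / 2\<close> cancels.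
\<close>

lemma weight27_neg_nonneg:
  assumes "Q2 r u \<le> 0"
  shows "0 \<le> weight27_neg r u"
proof -
  have "2 * weight27_neg r u = - Q2 r u + (2*r - 1)*u + 2*r*(1 - r) + r*u*(1 - r)
      + 2*r*u^2 + 3*r^2*u^2 + 3*r^2*u^3 + 2*r^3*u^2 + 2*r^3*u^3"
    unfolding weight27_neg_def Q2_def by algebra
  also have "0 \<le> \<dots>"
    using assms r u by (intro add_nonneg_nonneg) auto
  finally show ?thesis by simp
qed

lemma weight33_neg_nonneg:
  assumes "Q2 r u \<le> 0"
  shows "0 \<le> weight33_neg r u"
proof -
  have "2 * weight33_neg r u = - Q2 r u + 4*r*(1 - r) + u + 3*r*u + 3*r^2*u
      + r^2*u^2*(1 - u) + 2*r^3 + 2*r^3*u + 2*r^3*u^2*(1 - u) + 2*r^4*u + 4*r^4*u^2"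
    unfolding weight33_neg_def Q2_def by algebra
  also have "0 \<le> \<dots>"
    using assms r u by (intro add_nonneg_nonneg) auto
  finally show ?thesis by simp
qed

lemma weight38_neg_nonneg: "0 \<le> weight38_neg r u"
proof -
  have "r^2 * u \<le> 1"
    using r u by (intro mult_le_one power_le_one) auto
  then have "0 \<le> u * (1 - r^2*u)"
    using u by simp
  moreover have "weight38_neg r u = u * (1 - r^2*u) + (2*r*(1 - r) + 2*r*u*(1 - u)
      + 2*r^3 + 5*r^3*u + 2*r^3*u^2)"
    unfolding weight38_neg_def by algebra
  moreover have "0 \<le> 2*r*(1 - r) + 2*r*u*(1 - u) + 2*r^3 + 5*r^3*u + 2*r^3*u^2"
    using r u by (intro add_nonneg_nonneg) auto
  ultimately show ?thesis by linarith
qed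

text \<open>
  Subtracting \<open>2r\<^sup>2 K\<^sub>2\<close> leaves a polynomial whose part of degree at most one in \<open>u\<close> is nonnegative at
  \<open>u = 0\<close> and at \<open>u = 1\<close>. That part is written as the convex combination of these two values.
\<close>

lemma weight39_neg_nonneg:
  assumes "0 \<le> K2 r u"
  shows "0 \<le> weight39_neg r u"
proof -
  have "weight39_neg r u = 2*r^2 * K2 r u
      + (1 - u) * ((1 - r) * ((1 - r) + r^2 + 4*r^3))
      + u * ((2*r - 1) * (3*r - 1) + 8*r^3*(1 - r))
      + 2*r^2*u^2*(1 - u) + 2*r^2*u^3*((1 - r) * (1 + r)) + r^3*u^2 + 3*r^3*u^2*(1 - r)"
    unfolding weight39_neg_def K2_def by algebra
  also have "0 \<le> \<dots>"
    using assms r u by (intro add_nonneg_nonneg mult_nonneg_nonneg) auto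
  finally show ?thesis .
qed

end

lemma mixture_Q2_nonpos:
  fixes r u :: real
  assumes "0 < r" "r \<le> 1" "0 < u" "u \<le> 1" "0 \<le> K2 r u" "Q2 r u \<le> 0"
  shows "\<exists>w. searcher_mixture w \<and>
           supported_on w {policy26, policy27, policy33, policy38, policy39} \<and>
           (\<forall>x\<in>placements. expected_cost (box_costs 1 r (r * u)) w x \<le> V2 1 r (r * u))"
proof -
  let ?d = "value_denom r u" and ?e = "2*r - u + 5*r*u + 2*r*u^2"
  define M where "M = r * ?e * ?d"
  have r: "3/4 \<le> r"
    using assms by (intro r_lower_bound) auto
  have "0 < ?d"
    using assms by (intro value_denom_pos) auto
  have "0 < ?e"
  proof -
    have "u \<le> 2*r*u"
      using r assms by simp
    moreover have "0 < 2*r + 3*r*u + 2*r*u^2"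
      using assms by (simp add: add_pos_pos)
    ultimately show ?thesis by simp
  qed
  have V: "V2 1 r (r*u) * M = r * ?e * value_num r u"
    using \<open>0 < ?d\<close> by (simp add: V2_eq M_def)
  define n26 n27 n38
    where "n26 = r * weight26_neg r u" and "n27 = r * weight27_neg r u" and "n38 = r * weight38_neg r u"
  note defs = n26_def n27_def n38_def weight26_neg_def weight27_neg_def weight33_neg_def
    weight38_neg_def weight39_neg_def M_def value_denom_def value_num_def
  have total: "n26 + n27 + weight33_neg r u + n38 + weight39_neg r u = M"
    unfolding defs by algebra
  have nonneg: "0 \<le> n26" "0 \<le> n27" "0 \<le> weight33_neg r u" "0 \<le> n38" "0 \<le> weight39_neg r u"
    using assms r weight26_neg_nonneg weight27_neg_nonneg weight33_neg_nonneg
      weight38_neg_nonneg weight39_neg_nonneg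
    by (simp_all add: n26_def n27_def n38_def)
  have cost_002:
    "n26 * (1 + r + 2*(r*u)) + n27 * (1 + r + 2*(r*u)) + weight33_neg r u * (1 + r + 2*(r*u))
       + n38 * (1 + r + 2*(r*u)) + weight39_neg r u * (1 + r + 2*(r*u)) \<le> r * ?e * value_num r u"
  proof -
    have "n26 * (1 + r + 2*(r*u)) + n27 * (1 + r + 2*(r*u)) + weight33_neg r u * (1 + r + 2*(r*u))
         + n38 * (1 + r + 2*(r*u)) + weight39_neg r u * (1 + r + 2*(r*u))
        = (1 + r + 2*(r*u)) * M"
      unfolding total [symmetric] by algebra
    moreover have "0 \<le> r * ?e * ((1 + r) * K2 r u)"
      using assms \<open>0 < ?e\<close> by simp
    then have "(1 + r + 2*(r*u)) * M \<le> r * ?e * value_num r u"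
      unfolding value_minus_cost_002 [symmetric] M_def by (simp add: algebra_simps)
    ultimately show ?thesis by simp
  qed
  have costs:
    "n26 * (2*r + r*u) + n27 * (1 + r + r*u) + weight33_neg r u * (1 + r + r*u)
       + n38 * (1 + 2*r + r*u) + weight39_neg r u * (1 + 2*r + r*u) = r * ?e * value_num r u"
    "n26 * (2*r) + n27 * (2*r + r*u) + weight33_neg r u * (1 + 2*r + r*u)
       + n38 * (1 + 2*r) + weight39_neg r u * (1 + 2*r) = r * ?e * value_num r u"
    "n26 * (2 + r + r*u) + n27 * (1 + r*u) + weight33_neg r u * (2 + r + r*u)
       + n38 * (1 + r + r*u) + weight39_neg r u * (2 + r*u) = r * ?e * value_num r u"
    "n26 * (1 + 2*r + r*u) + n27 * (1 + 2*r + r*u) + weight33_neg r u * (2 + r)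
       + n38 * (1 + r) + weight39_neg r u * (2 + r + r*u) = r * ?e * value_num r u"
    "n26 * (2 + r) + n27 * (2 + r + r*u) + weight33_neg r u * 2
       + n38 * (2 + r + r*u) + weight39_neg r u * 2 = r * ?e * value_num r u"
    unfolding defs by algebra+
  show ?thesis
  proof (rule mixture_from_unnormalised_weights)
    let ?ps = "[(policy26, n26), (policy27, n27), (policy33, weight33_neg r u),
                 (policy38, n38), (policy39, weight39_neg r u)]"
    show "0 < M"
      using assms \<open>0 < ?d\<close> \<open>0 < ?e\<close> by (simp add: M_def)
    show "(\<Sum>(p, n)\<leftarrow>?ps. n) = M"
      by (simp add: total [symmetric])
    show "\<forall>(p, n) \<in> set ?ps. 0 \<le> n"
      using nonneg by simp
    show "fst ` set ?ps \<subseteq> game_policies"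
      by (simp add: game_policies)
    show "(\<Sum>(p, n)\<leftarrow>?ps. n * search_cost (box_costs 1 r (r * u)) p x) \<le> V2 1 r (r * u) * M"
      if "x \<in> placements" for x
      using that costs cost_002
      by (cases rule: placements_cases)
        (simp_all add: cost_table_entries V add.assoc del: One_nat_def)
  qed simp
qed

theorem lemma2:
  fixes r u :: real
  assumes "0 < r" and "r \<le> 1" and "0 < u" and "u \<le> 1"
    and "A2 r u \<ge> 0" and "K2 r u \<ge> 0"
  shows "(Q2 r u \<le> 0 \<longrightarrow>
            (\<exists>w. searcher_mixture w \<and>
                 supported_on w {policy26, policy27, policy33, policy38, policy39} \<and>
                 (\<forall>x\<in>placements. expected_cost (box_costs 1 r (r * u)) w x \<le> V2 1 r (r * u)))) \<and>
         (Q2 r u \<ge> 0 \<longrightarrow>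
            (\<exists>w. searcher_mixture w \<and>
                 supported_on w {policy26, policy33, policy37, policy38, policy41} \<and>
                 (\<forall>x\<in>placements. expected_cost (box_costs 1 r (r * u)) w x \<le> V2 1 r (r * u))))"
  using assms mixture_Q2_nonneg mixture_Q2_nonpos by simp

end
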